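(* Let $D$ be an integral domain with quotient field $K$, and let $T$ be an indeterminate. The following conditions are equivalent. (1) $D[T]$ is a TPDF-domain. (2) $D$ is a TPDF-domain, and every non-constant primitive polynomial over $D$ (in $D[T]$) has a prime factorization in $D[T]$. (3) $D$ is a TPDF-domain, $D$ is a PSP-domain, and every non-constant irreducible polynomial in $D[T]$ is irreducible in $K[T]$.
   Context: A prime element of an integral domain is a nonzero nonunit $p$ such that $p\mid ab$ implies $p\mid a$ or $p\mid b$. An irreducible element is a nonunit $a$ such that $a=bc$ implies that $b$ or $c$ is a unit. An integral domain is a TPDF-domain if every nonzero nonunit element has at least one prime divisor (strong Furstenberg property) and every nonzero element has only finitely many prime divisors up to associates (PDF property). A prime factorization of an element is an expression of it as a finite product of prime elements. A nonzero polynomial $f\in D[T]$ is primitive (over $D$) if its coefficients have no common nonunit divisor in $D$. The content $A_f$ is the (fractional) ideal of $D$ generated by the coefficients of $f$, and $A_f^{-1}=\{x\in K\mid xA_f\subseteq D\}$. The polynomial $f$ is super-primitive if $A_f^{-1}=D$. $D$ is a PSP-domain if every primitive polynomial $f\in D[T]$ is super-primitive. *)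

theory Defs
  imports
    "HOL-Library.Multiset"
    "HOL-Computational_Algebra.Fraction_Field"
    "HOL-Computational_Algebra.Polynomial_Factorial"
begin

text \<open>
  An integral domain D is a type of class \<open>idom\<close>; its quotient field K is the type of
  fractions over D, with D embedded via \<open>to_fract\<close>. Properties of the domain itself take the
  type as an argument, so that they can be applied both to D and to D[T].
\<close>

definition associates_rel :: "('a::idom \<times> 'a) set" where
  "associates_rel = {(a, b). \<exists>u. u dvd 1 \<and> b = u * a}"

definition strong_Furstenberg :: "'a::idom itself \<Rightarrow> bool" where
  "strong_Furstenberg _ \<longleftrightarrow>
     (\<forall>x::'a. x \<noteq> 0 \<and> \<not> x dvd 1 \<longrightarrow> (\<exists>p. prime_elem p \<and> p dvd x))"

definition PDF_domain :: "'a::idom itself \<Rightarrow> bool" where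
  "PDF_domain _ \<longleftrightarrow>
     (\<forall>x::'a. x \<noteq> 0 \<longrightarrow> finite ({p. prime_elem p \<and> p dvd x} // associates_rel))"

definition TPDF_domain :: "'a::idom itself \<Rightarrow> bool" where
  "TPDF_domain D \<longleftrightarrow> strong_Furstenberg D \<and> PDF_domain D"

definition has_prime_factorization :: "'a::idom \<Rightarrow> bool" where
  "has_prime_factorization x \<longleftrightarrow> (\<exists>P. (\<forall>p\<in>#P. prime_elem p) \<and> x = prod_mset P)"

definition primitive_poly :: "'a::idom poly \<Rightarrow> bool" where
  "primitive_poly f \<longleftrightarrow> f \<noteq> 0 \<and> (\<forall>d. (\<forall>i. d dvd coeff f i) \<longrightarrow> d dvd 1)"

global_interpretation fract_module: module "\<lambda>(c::'a::idom) (x::'a fract). to_fract c * x"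
  by unfold_locales (simp_all add: algebra_simps)

text \<open>
  The content A of f is realized inside K, as the D-submodule generated by the coefficients.
\<close>

definition content_ideal :: "'a::idom poly \<Rightarrow> 'a fract set" where
  "content_ideal f = fract_module.span (to_fract ` set (coeffs f))"

definition fractional_inverse :: "'a::idom fract set \<Rightarrow> 'a fract set" where
  "fractional_inverse A = {x. \<forall>a\<in>A. x * a \<in> range to_fract}"

definition super_primitive_poly :: "'a::idom poly \<Rightarrow> bool" where
  "super_primitive_poly f \<longleftrightarrow> fractional_inverse (content_ideal f) = range to_fract"

definition PSP_domain :: "'a::idom itself \<Rightarrow> bool" where
  "PSP_domain _ \<longleftrightarrow> (\<forall>f::'a poly. primitive_poly f \<longrightarrow> super_primitive_poly f)"

end

theory Submission
  imports Defs
begin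

text \<open>
  Everything is governed by how the nonconstant primes of \<open>D[T]\<close> interact with the constants.

  For the first equivalence, suppose that every nonzero nonunit of \<open>D[T]\<close> has a prime divisor.
  A primitive polynomial has only primitive factors, and a constant primitive polynomial is a unit.
  Splitting off prime divisors therefore lowers the degree at each step and ends in a prime
  factorization (\<open>primitive_poly_has_prime_factorization\<close>). Conversely, a nonzero nonunit polynomial is
  either primitive, and then it is divisible by some prime of its factorization, or it is
  divisible by a nonunit constant, which has a prime divisor in \<open>D\<close>. The finiteness condition
  on prime divisors is inherited by \<open>D\<close> from \<open>D[T]\<close> and conversely: constant prime
  divisors of \<open>f\<close> divide its leading coefficient, and pairwise nonassociate nonconstant ones
  number at most \<open>degree f\<close> (\<open>card_nonassociate_prime_divisors_le_degree\<close>).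

  For the second equivalence, a nonconstant prime of \<open>D[T]\<close> divides no nonzero constant. Hence
  it can be cancelled from a divisibility by a constant, which makes every primitive
  product of primes super-primitive, and it stays irreducible over the quotient field
  \<open>K\<close>, as denominators can be cleared. The converse rests on a Gauss lemma for super-primitive
  polynomials (\<open>super_primitive_cancel_const\<close>): a constant dividing \<open>f g\<close> divides \<open>g\<close> when \<open>f\<close>
  is super-primitive. It turns divisibility by \<open>f\<close> in \<open>K[T]\<close> into divisibility in \<open>D[T]\<close>, so
  that a super-primitive polynomial that is irreducible, hence prime, over \<open>K\<close> is prime in
  \<open>D[T]\<close>. A primitive polynomial is a product of irreducible ones by induction on the degree,
  and under the third condition each of these is prime.
\<close>

section \<open>Associates\<close>

lemma associates_rel_iff: "(a, b) \<in> associates_rel \<longleftrightarrow> a dvd b \<and> b dvd (a::'a::idom)"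
proof
  assume "(a, b) \<in> associates_rel"
  then obtain u where u: "u dvd 1" "b = u * a" by (auto simp: associates_rel_def)
  then obtain v where "1 = u * v" by (auto elim: dvdE)
  then have "a = b * v" using u(2) by (simp add: ac_simps)
  then show "a dvd b \<and> b dvd a" using u(2) by (metis dvd_triv_left dvd_triv_right)
next
  assume "a dvd b \<and> b dvd a"
  then obtain u v where u: "b = a * u" and v: "a = b * v" unfolding dvd_def by blast
  show "(a, b) \<in> associates_rel"
  proof (cases "a = 0")
    case True
    then show ?thesis using u by (auto simp: associates_rel_def intro: exI[of _ 1])
  next
    case False
    have "a * 1 = a * (u * v)" using u v by (metis mult.assoc mult.right_neutral)
    then have "1 = u * v" using False mult_left_cancel by blast
    then have "u dvd 1" by (metis dvd_triv_left)
    then show ?thesis using u by (auto simp: associates_rel_def ac_simps)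
  qed
qed

lemma associates_class_eqI:
  assumes "a dvd b" "b dvd (a::'a::idom)"
  shows "associates_rel `` {a} = associates_rel `` {b}"
  using assms by (auto simp: associates_rel_iff intro: dvd_trans)

lemma prime_elem_cofactor_unit:
  fixes p k :: "'a::idom"
  assumes "prime_elem (p * k)" "\<not> p dvd 1"
  shows "k dvd 1"
proof -
  have nz: "p \<noteq> 0" "k \<noteq> 0" using assms(1) by (auto simp: prime_elem_def)
  have "p * k dvd p \<or> p * k dvd k" using prime_elem_dvd_multD[OF assms(1), of p k] by simp
  then have "p * k dvd p * 1 \<or> p * k dvd 1 * k" by simp
  then show ?thesis using nz assms(2) by (simp only: dvd_mult_cancel_left dvd_mult_cancel_right) auto
qed

lemma prime_elem_dvd_prime_elem_sym:
  assumes "prime_elem p" "prime_elem q" "p dvd (q::'a::idom)"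
  shows "q dvd p"
proof -
  obtain k where k: "q = p * k" using assms(3) by (elim dvdE)
  then have "k dvd 1"
    using prime_elem_cofactor_unit assms(1,2) prime_elem_not_unit by blast
  then obtain l where "1 = k * l" by (elim dvdE)
  then have "p = q * l" using k by (simp add: ac_simps)
  then show ?thesis by simp
qed

text \<open>
  The units of \<open>D[T]\<close> are the units of \<open>D\<close>, so passing to \<open>D[T]\<close> does not enlarge the class of a
  constant.
\<close>
lemma associates_class_const_poly:
  "associates_rel `` {[:p:]} = (\<lambda>c. [:c:]) ` (associates_rel `` {p::'a::idom})"
proof -
  have "q \<in> (\<lambda>c. [:c:]) ` (associates_rel `` {p})" if "(([:p:]), q) \<in> associates_rel" for q
  proof -
    from that obtain u where u: "u dvd 1" "q = u * [:p:]" by (auto simp: associates_rel_def)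
    from u(1) obtain c where "u = [:c:]" "c dvd 1" by (auto simp: is_unit_poly_iff)
    then have "q = [:c * p:]" "c dvd 1" using u(2) by (simp_all add: mult.commute)
    then show ?thesis unfolding associates_rel_def by blast
  qed
  moreover have "[:q:] \<in> associates_rel `` {[:p:]}" if "(p, q) \<in> associates_rel" for q
    using that by (simp add: associates_rel_iff)
  ultimately show ?thesis by blast
qed


section \<open>Primitive polynomials\<close>

lemma primitive_poly_iff:
  "primitive_poly f \<longleftrightarrow> f \<noteq> 0 \<and> (\<forall>d. [:d:] dvd f \<longrightarrow> d dvd 1)"
  by (simp add: primitive_poly_def const_poly_dvd_iff)

lemma primitive_poly_factor:
  assumes "primitive_poly f" "g dvd f"
  shows "primitive_poly g"
  using assms by (auto simp: primitive_poly_iff intro: dvd_trans)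

lemma primitive_poly_degree_0_unit:
  assumes "primitive_poly f" "degree f = 0"
  shows "f dvd 1"
proof -
  obtain c where c: "f = [:c:]" using degree_eq_zeroE[OF assms(2)] .
  then have "c dvd 1" using assms(1) by (auto simp: primitive_poly_iff)
  then show ?thesis using c by (simp add: is_unit_const_poly_iff)
qed

lemma degree_pos_not_unit:
  fixes f :: "'a::idom poly"
  shows "degree f > 0 \<Longrightarrow> \<not> f dvd 1"
  by (auto simp: is_unit_poly_iff)

text \<open>
  In \<open>f = [:d:] * g\<close> the factor \<open>g\<close> carries the whole degree and is no unit, so \<open>d\<close> must be one.
\<close>
lemma irreducible_degree_pos_primitive:
  fixes f :: "'a::idom poly"
  assumes "irreducible f" "degree f > 0"
  shows "primitive_poly f"
  unfolding primitive_poly_iff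
proof (intro conjI allI impI)
  show "f \<noteq> 0" using assms(2) by auto
  fix d assume "[:d:] dvd f"
  then obtain g where g: "f = [:d:] * g" by (elim dvdE)
  have "degree g > 0" using assms(2) g by (cases "d = 0") auto
  then have "[:d:] dvd 1"
    using irreducibleD[OF assms(1) g] degree_pos_not_unit by blast
  then show "d dvd 1" by (simp add: is_unit_const_poly_iff)
qed

lemma nonconstant_not_dvd_const:
  fixes p :: "'a::idom poly"
  assumes "degree p > 0" "b \<noteq> 0"
  shows "\<not> p dvd [:b:]"
  using assms dvd_imp_degree_le[of p "[:b:]"] by auto

lemma prime_factor_degree_less:
  fixes p g :: "'a::idom poly"
  assumes "p * g \<noteq> 0" "degree p > 0"
  shows "degree g < degree (p * g)"
  using assms by (subst degree_mult_eq) auto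


section \<open>Prime factorizations\<close>

lemma has_prime_factorization_prime_elem:
  "prime_elem p \<Longrightarrow> has_prime_factorization p"
  unfolding has_prime_factorization_def by (intro exI[of _ "{#p#}"]) simp

lemma has_prime_factorization_mult:
  assumes "has_prime_factorization x" "has_prime_factorization y"
  shows "has_prime_factorization (x * y)"
proof -
  from assms obtain P Q where "\<forall>p\<in>#P. prime_elem p" "x = prod_mset P"
    "\<forall>p\<in>#Q. prime_elem p" "y = prod_mset Q"
    unfolding has_prime_factorization_def by blast
  then show ?thesis
    unfolding has_prime_factorization_def by (intro exI[of _ "P + Q"]) auto
qed

lemma prime_elem_mult_unit:
  fixes p u :: "'a::idom"
  assumes "prime_elem p" "u dvd 1"
  shows "prime_elem (p * u)"
proof -
  obtain v where v: "1 = u * v" using assms(2) by (elim dvdE)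
  have "p * u dvd x" if "p dvd x" for x
  proof -
    from that obtain y where "x = p * y" by (elim dvdE)
    then have "x = (p * u) * (v * y)" using v by (metis mult.assoc mult.right_neutral)
    then show ?thesis by simp
  qed
  then have "p * u dvd x \<longleftrightarrow> p dvd x" for x by (metis dvd_mult_left)
  moreover have "p * u \<noteq> 0" using assms v by auto
  ultimately show ?thesis using assms(1) by (simp add: prime_elem_def)
qed

lemma has_prime_factorization_imp_prime_divisor:
  assumes "has_prime_factorization x" "\<not> x dvd (1::'a::idom)"
  shows "\<exists>p. prime_elem p \<and> p dvd x"
proof -
  from assms(1) obtain P where P: "\<forall>p\<in>#P. prime_elem p" "x = prod_mset P"
    unfolding has_prime_factorization_def by blast
  from P(2) assms(2) obtain p where "p \<in># P" by (metis dvd_refl multiset_nonemptyE prod_mset_empty)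
  then show ?thesis using P dvd_prod_mset by blast
qed

text \<open>
  Induction on the degree. A prime divisor of \<open>f\<close> is primitive and not a unit, so it is nonconstant
  and its cofactor has smaller degree; the cofactor is primitive too, hence a unit as soon as
  it is constant.
\<close>
lemma primitive_poly_has_prime_factorization:
  fixes f :: "'a::idom poly"
  assumes "strong_Furstenberg TYPE('a poly)" "primitive_poly f" "degree f > 0"
  shows "has_prime_factorization f"
  using assms(2,3)
proof (induction "degree f" arbitrary: f rule: less_induct)
  case less
  have "f \<noteq> 0" using less.prems by auto
  with assms(1) degree_pos_not_unit[OF less.prems(2)] obtain p where p: "prime_elem p" "p dvd f"
    unfolding strong_Furstenberg_def by blast
  obtain g where g: "f = p * g" using p(2) by (elim dvdE)
  have prim: "primitive_poly p" "primitive_poly g"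
    using primitive_poly_factor[OF less.prems(1)] g by auto
  have dp: "degree p > 0"
    using primitive_poly_degree_0_unit[OF prim(1)] p(1) prime_elem_not_unit by blast
  show ?case
  proof (cases "degree g = 0")
    case True
    then have "g dvd 1" using primitive_poly_degree_0_unit prim(2) by blast
    then show ?thesis
      using prime_elem_mult_unit[OF p(1)] has_prime_factorization_prime_elem g by metis
  next
    case False
    then have "has_prime_factorization g"
      using less.hyps[of g] prim(2) prime_factor_degree_less[of p g] dp \<open>f \<noteq> 0\<close> g by simp
    then show ?thesis
      using has_prime_factorization_mult has_prime_factorization_prime_elem p(1) g by metis
  qed
qed

lemma irreducible_has_prime_factorization_imp_prime_elem:
  fixes f :: "'a::idom"
  assumes "irreducible f" "has_prime_factorization f"
  shows "prime_elem f"
proof -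
  obtain p where p: "prime_elem p" "p dvd f"
    using has_prime_factorization_imp_prime_divisor[OF assms(2)] assms(1)
    by (auto simp: irreducible_def)
  then obtain u where u: "f = p * u" by (elim dvdE)
  then have "u dvd 1" using irreducibleD[OF assms(1) u] prime_elem_not_unit[OF p(1)] by blast
  then show ?thesis using prime_elem_mult_unit[OF p(1)] u by simp
qed


section \<open>The two defining properties of a TPDF-domain for a polynomial ring\<close>

lemma strong_Furstenberg_coefficients:
  assumes "strong_Furstenberg TYPE('a::idom poly)"
  shows "strong_Furstenberg TYPE('a)"
  unfolding strong_Furstenberg_def
proof (intro allI impI)
  fix x :: 'a assume x: "x \<noteq> 0 \<and> \<not> x dvd 1"
  then have "[:x:] \<noteq> 0 \<and> \<not> [:x:] dvd 1" by (simp add: is_unit_const_poly_iff)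
  with assms obtain p where p: "prime_elem p" "p dvd [:x:]"
    unfolding strong_Furstenberg_def by blast
  have "degree p = 0" using nonconstant_not_dvd_const[of p x] p(2) x by auto
  then obtain c where c: "p = [:c:]" by (rule degree_eq_zeroE)
  then show "\<exists>p. prime_elem p \<and> p dvd x"
    using p prime_elem_const_poly_iff by auto
qed

text \<open>
  A nonunit that is not primitive has a nonunit constant divisor; a prime of \<open>D\<close> dividing that
  constant stays prime in \<open>D[T]\<close>.
\<close>
lemma strong_Furstenberg_poly:
  assumes "strong_Furstenberg TYPE('a::idom)"
    and "\<And>f::'a poly. degree f > 0 \<Longrightarrow> primitive_poly f \<Longrightarrow> has_prime_factorization f"
  shows "strong_Furstenberg TYPE('a poly)"
  unfolding strong_Furstenberg_def
proof (intro allI impI)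
  fix f :: "'a poly" assume f: "f \<noteq> 0 \<and> \<not> f dvd 1"
  show "\<exists>p. prime_elem p \<and> p dvd f"
  proof (cases "primitive_poly f")
    case True
    then have "degree f > 0" using f primitive_poly_degree_0_unit by blast
    then show ?thesis using assms(2) True has_prime_factorization_imp_prime_divisor f by blast
  next
    case False
    then obtain d where d: "[:d:] dvd f" "\<not> d dvd 1" using f by (auto simp: primitive_poly_iff)
    then have "d \<noteq> 0" using f by auto
    with assms(1) d(2) obtain p where p: "prime_elem p" "p dvd d"
      unfolding strong_Furstenberg_def by blast
    have "[:p:] dvd [:d:]" using p(2) by simp
    then have "[:p:] dvd f" using d(1) dvd_trans by blast
    then show ?thesis using p(1) lift_prime_elem_poly by blast
  qed
qed

text \<open>
  Primes of \<open>D\<close> dividing \<open>x\<close> are primes of \<open>D[T]\<close> dividing the constant \<open>x\<close>, and the class of \<open>p\<close>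
  in \<open>D\<close> is recovered from the class of \<open>[:p:]\<close> as the set of constants in it.
\<close>
lemma PDF_domain_coefficients:
  assumes "PDF_domain TYPE('a::idom poly)"
  shows "PDF_domain TYPE('a)"
  unfolding PDF_domain_def
proof (intro allI impI)
  fix x :: 'a assume "x \<noteq> 0"
  let ?A = "{p. prime_elem p \<and> p dvd x}" and ?B = "{p. prime_elem p \<and> p dvd [:x:]}"
  have "finite (?B // associates_rel)"
    using assms \<open>x \<noteq> 0\<close> unfolding PDF_domain_def by simp
  moreover have "?A // associates_rel \<subseteq> vimage (\<lambda>c. [:c:]) ` (?B // associates_rel)"
  proof
    fix X assume "X \<in> ?A // associates_rel"
    then obtain p where p: "prime_elem p" "p dvd x" "X = associates_rel `` {p}"
      by (auto elim!: quotientE)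
    have "X = (\<lambda>c. [:c:]) -` (associates_rel `` {[:p:]})"
      unfolding p(3) by (auto simp: associates_rel_iff)
    moreover have "associates_rel `` {[:p:]} \<in> ?B // associates_rel"
      using p by (intro quotientI) (auto intro: lift_prime_elem_poly)
    ultimately show "X \<in> vimage (\<lambda>c. [:c:]) ` (?B // associates_rel)" by blast
  qed
  ultimately show "finite (?A // associates_rel)"
    using finite_subset finite_imageI by blast
qed

text \<open>
  Divide \<open>f\<close> by one of the primes: the others still divide the quotient, because they do not
  divide the prime removed, while the degree has dropped by at least one.
\<close>
lemma card_nonassociate_prime_divisors_le_degree:
  fixes f :: "'a::idom poly"
  assumes "finite R" "f \<noteq> 0"
    and "\<And>p. p \<in> R \<Longrightarrow> prime_elem p \<and> degree p > 0 \<and> p dvd f"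
    and "\<And>p q. p \<in> R \<Longrightarrow> q \<in> R \<Longrightarrow> p dvd q \<Longrightarrow> p = q"
  shows "card R \<le> degree f"
  using assms
proof (induction R arbitrary: f rule: finite_induct)
  case empty
  then show ?case by simp
next
  case (insert p R)
  have p: "prime_elem p" "degree p > 0" "p dvd f" using insert.prems(2)[of p] by auto
  obtain g where g: "f = p * g" using p(3) by (elim dvdE)
  have "card R \<le> degree g"
  proof (rule insert.IH)
    show "g \<noteq> 0" using g insert.prems(1) by auto
    fix q assume q: "q \<in> R"
    \<comment> \<open>\<open>q\<close> divides \<open>p * g\<close> but not \<open>p\<close>, so it survives the division\<close>
    have "\<not> q dvd p" using insert.prems(3)[of q p] q insert.hyps(2) by auto
    then show "prime_elem q \<and> degree q > 0 \<and> q dvd g"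
      using insert.prems(2)[of q] q g by (auto dest: prime_elem_dvd_multD)
  next
    show "q = r" if "q \<in> R" "r \<in> R" "q dvd r" for q r
      using insert.prems(3)[of q r] that by auto
  qed
  also have "degree g < degree f" using prime_factor_degree_less[of p g] p(2) insert.prems(1) g by simp
  finally show ?case using insert.hyps by simp
qed

text \<open>
  Representatives of finitely many distinct classes are pairwise nonassociate primes, so the degree
  bounds the size of every finite set of classes, and therefore of the whole set.
\<close>
lemma finite_nonconstant_prime_divisors:
  fixes f :: "'a::idom poly"
  assumes "f \<noteq> 0"
  shows "finite ({p. prime_elem p \<and> degree p > 0 \<and> p dvd f} // associates_rel)" (is "finite (?S // _)")
proof -
  have "card G \<le> degree f" if G: "G \<subseteq> ?S // associates_rel" "finite G" for G
  proof -
    have "\<forall>X\<in>G. \<exists>p. p \<in> ?S \<and> X = associates_rel `` {p}"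
      using G(1) by (auto simp: quotient_def)
    then obtain r where r: "\<And>X. X \<in> G \<Longrightarrow> r X \<in> ?S \<and> X = associates_rel `` {r X}"
      by metis
    have eqI: "X = Y" if "X \<in> G" "Y \<in> G" "associates_rel `` {r X} = associates_rel `` {r Y}" for X Y
      using r[OF that(1)] r[OF that(2)] that(3) by simp
    have inj: "inj_on r G" by (rule inj_onI) (rule eqI, auto)
    have "card (r ` G) \<le> degree f"
    proof (rule card_nonassociate_prime_divisors_le_degree)
      show "finite (r ` G)" using G(2) by simp
      show "f \<noteq> 0" by fact
      show "prime_elem p \<and> degree p > 0 \<and> p dvd f" if "p \<in> r ` G" for p
        using that r by blast
      fix p q assume "p \<in> r ` G" "q \<in> r ` G" and dvd: "p dvd q"
      then obtain X Y where XY: "X \<in> G" "Y \<in> G" "p = r X" "q = r Y" by blast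
      have "prime_elem p" "prime_elem q" using r XY by auto
      then have "q dvd p" using dvd prime_elem_dvd_prime_elem_sym by blast
      then have "X = Y" using eqI XY associates_class_eqI[OF dvd] by blast
      then show "p = q" using XY by simp
    qed
    then show ?thesis by (simp add: card_image[OF inj])
  qed
  then show ?thesis using finite_if_finite_subsets_card_bdd[of "?S // associates_rel"] by blast
qed

text \<open>
  A constant prime divisor of \<open>f\<close> divides every coefficient, in particular the leading one, which
  is nonzero and so has finitely many prime divisors in \<open>D\<close>.
\<close>
lemma PDF_domain_poly:
  assumes "PDF_domain TYPE('a::idom)"
  shows "PDF_domain TYPE('a poly)"
  unfolding PDF_domain_def
proof (intro allI impI)
  fix f :: "'a poly" assume f: "f \<noteq> 0"
  let ?A = "{p. prime_elem p \<and> p dvd lead_coeff f}"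
  let ?S = "{p. prime_elem p \<and> degree p > 0 \<and> p dvd f}"
  have fin: "finite (?A // associates_rel)"
    using assms f unfolding PDF_domain_def by simp
  have "{p. prime_elem p \<and> p dvd f} // associates_rel
          \<subseteq> ?S // associates_rel \<union> image (\<lambda>c. [:c:]) ` (?A // associates_rel)"
  proof
    fix X assume "X \<in> {p. prime_elem p \<and> p dvd f} // associates_rel"
    then obtain p where p: "prime_elem p" "p dvd f" "X = associates_rel `` {p}"
      by (auto elim!: quotientE)
    show "X \<in> ?S // associates_rel \<union> image (\<lambda>c. [:c:]) ` (?A // associates_rel)"
    proof (cases "degree p = 0")
      case True
      then obtain c where c: "p = [:c:]" by (rule degree_eq_zeroE)
      have "c \<in> ?A" using p c by (auto simp: prime_elem_const_poly_iff const_poly_dvd_iff)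
      then have "associates_rel `` {c} \<in> ?A // associates_rel" by (rule quotientI)
      then show ?thesis using p(3) c associates_class_const_poly[of c] by blast
    next
      case False
      then have "X \<in> ?S // associates_rel" using p by (auto intro: quotientI)
      then show ?thesis by blast
    qed
  qed
  then show "finite ({p. prime_elem p \<and> p dvd f} // associates_rel)"
    using fin finite_nonconstant_prime_divisors[OF f] by (meson finite_UnI finite_imageI finite_subset)
qed


section \<open>Super-primitive polynomials\<close>

text \<open>
  Multiplication by \<open>a / b\<close> sends a \<open>D\<close>-submodule of \<open>K\<close> into \<open>D\<close> once it does so on generators.
  This turns the fractional inverse of the content into divisibilities in \<open>D\<close>.
\<close>
lemma mem_fractional_inverse_content_ideal:
  fixes f :: "'a::idom poly"
  assumes "b \<noteq> 0"
  shows "to_fract a / to_fract b \<in> fractional_inverse (content_ideal f)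
           \<longleftrightarrow> (\<forall>i. b dvd a * coeff f i)"
proof -
  let ?x = "to_fract a / to_fract b :: 'a fract"
  let ?T = "{y. ?x * y \<in> range to_fract}"
  have sub: "fract_module.subspace ?T"
  proof (rule fract_module.subspaceI)
    show "0 \<in> ?T" by (auto intro: range_eqI[of _ _ 0])
    fix y z assume "y \<in> ?T" "z \<in> ?T"
    then obtain u v where "?x * y = to_fract u" "?x * z = to_fract v" by auto
    then have "?x * (y + z) = to_fract (u + v)" by (simp only: distrib_left to_fract_add)
    then show "y + z \<in> ?T" by blast
  next
    fix c and y assume "y \<in> ?T"
    then obtain u where "?x * y = to_fract u" by auto
    then have "?x * (to_fract c * y) = to_fract (c * u)"
      by (simp only: to_fract_mult mult.left_commute)
    then show "to_fract c * y \<in> ?T" by blast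
  qed
  have mem: "to_fract c \<in> ?T \<longleftrightarrow> b dvd a * c" for c
  proof -
    have "?x * to_fract c = to_fract d \<longleftrightarrow> a * c = b * d" for d
    proof -
      have "?x * to_fract c = to_fract d \<longleftrightarrow> to_fract (a * c) = to_fract (b * d)"
        using assms by (simp add: field_simps)
      then show ?thesis by (simp only: to_fract_eq_iff)
    qed
    then show ?thesis by (auto simp: dvd_def)
  qed
  have span: "fract_module.span S \<subseteq> ?T \<longleftrightarrow> S \<subseteq> ?T" for S
    using fract_module.span_minimal[OF _ sub, of S] fract_module.span_superset[of S]
    by (meson subset_trans)
  have "?x \<in> fractional_inverse (content_ideal f) \<longleftrightarrow> content_ideal f \<subseteq> ?T"
    by (auto simp: fractional_inverse_def)
  also have "\<dots> \<longleftrightarrow> to_fract ` set (coeffs f) \<subseteq> ?T"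
    unfolding content_ideal_def by (rule span)
  also have "\<dots> \<longleftrightarrow> (\<forall>c\<in>set (coeffs f). b dvd a * c)"
    unfolding image_subset_iff by (simp only: mem)
  also have "\<dots> \<longleftrightarrow> (\<forall>c\<in>range (coeff f). b dvd a * c)"
    by (simp add: range_coeff)
  finally show ?thesis by simp
qed

text \<open>
  Super-primitivity inside \<open>D\<close>, with elements of \<open>K\<close> written as fractions \<open>a / b\<close>; all later
  arguments use this form.
\<close>
lemma super_primitive_poly_iff:
  fixes f :: "'a::idom poly"
  shows "super_primitive_poly f \<longleftrightarrow>
           (\<forall>a b. b \<noteq> 0 \<longrightarrow> (\<forall>i. b dvd a * coeff f i) \<longrightarrow> b dvd a)"
proof -
  let ?I = "fractional_inverse (content_ideal f)"
  have range: "to_fract a / to_fract b \<in> range to_fract \<longleftrightarrow> b dvd a" if "b \<noteq> 0" for a b :: 'a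
  proof -
    have "to_fract a / to_fract b = to_fract d \<longleftrightarrow> a = b * d" for d
      using that to_fract_eq_iff[of a "b * d"] by (simp add: field_simps del: to_fract_eq_iff)
    then show ?thesis by (auto simp: dvd_def)
  qed
  have frac: "\<exists>a b. b \<noteq> 0 \<and> x = to_fract a / to_fract b" for x :: "'a fract"
    by (cases x) (auto simp: Fract_conv_to_fract)
  have "range to_fract \<subseteq> ?I"
  proof
    fix x assume "x \<in> range (to_fract :: 'a \<Rightarrow> 'a fract)"
    then obtain a where "x = to_fract a / to_fract 1" by auto
    then show "x \<in> ?I" using mem_fractional_inverse_content_ideal[of 1 a f] by simp
  qed
  then have "super_primitive_poly f \<longleftrightarrow> (\<forall>x. x \<in> ?I \<longrightarrow> x \<in> range to_fract)"
    unfolding super_primitive_poly_def by blast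
  also have "\<dots> \<longleftrightarrow> (\<forall>a b. b \<noteq> 0 \<longrightarrow> to_fract a / to_fract b \<in> ?I
                                \<longrightarrow> to_fract a / to_fract b \<in> range to_fract)"
  proof (intro iffI allI impI)
    fix x assume *: "\<forall>a b. b \<noteq> 0 \<longrightarrow> to_fract a / to_fract b \<in> ?I
                        \<longrightarrow> to_fract a / to_fract b \<in> range to_fract" and x: "x \<in> ?I"
    obtain a b where "b \<noteq> 0" "x = to_fract a / to_fract b" using frac by blast
    with * x show "x \<in> range to_fract" by blast
  qed blast
  finally show ?thesis by (simp add: mem_fractional_inverse_content_ideal range)
qed

lemma super_primitive_poly_unit:
  fixes f :: "'a::idom poly"
  assumes "f dvd 1"
  shows "super_primitive_poly f"
proof -
  from assms obtain c where c: "f = [:c:]" "c dvd 1" by (auto simp: is_unit_poly_iff)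
  then obtain d where d: "1 = c * d" by (elim dvdE)
  have "b dvd a" if "b dvd a * coeff f 0" for a b
  proof -
    from that have "b dvd a * c * d" using c(1) by simp
    also have "a * c * d = a" using d by (metis mult.assoc mult.right_neutral)
    finally show ?thesis .
  qed
  then show ?thesis unfolding super_primitive_poly_iff by blast
qed

text \<open>
  In \<open>p * g = [:b:] * h\<close> the prime \<open>p\<close> divides the right-hand side and, being nonconstant, not
  \<open>[:b:]\<close>; so it divides \<open>h\<close> and cancels.
\<close>
lemma prime_elem_cancel_const:
  fixes p g :: "'a::idom poly"
  assumes "prime_elem p" "degree p > 0" "b \<noteq> 0" "[:b:] dvd p * g"
  shows "[:b:] dvd g"
proof -
  obtain h where h: "p * g = [:b:] * h" using assms(4) by (elim dvdE)
  then have "p dvd [:b:] * h" by (metis dvd_triv_left)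
  then have "p dvd h"
    using prime_elem_dvd_multD[OF assms(1)] nonconstant_not_dvd_const[OF assms(2,3)] by blast
  then obtain k where "h = p * k" by (elim dvdE)
  then have "p * g = p * ([:b:] * k)" using h by (simp only: mult.left_commute)
  then have "g = [:b:] * k" using assms(1) by (metis mult_left_cancel not_prime_elem_zero)
  then show ?thesis by (metis dvd_triv_left)
qed

lemma prod_mset_prime_cancel_const:
  fixes g :: "'a::idom poly"
  assumes "\<forall>p\<in>#P. prime_elem p \<and> degree p > 0" "b \<noteq> 0" "[:b:] dvd prod_mset P * g"
  shows "[:b:] dvd g"
  using assms(1,3)
proof (induction P)
  case empty
  then show ?case by simp
next
  case (add p P)
  have "[:b:] dvd prod_mset P * g"
    using add.prems prime_elem_cancel_const[of p b "prod_mset P * g"] assms(2)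
    by (simp add: mult.assoc)
  then show ?case using add by simp
qed

text \<open>
  All prime factors of a primitive polynomial are nonconstant. Cancelling them one after another
  from \<open>b\<close> dividing \<open>f * [:a:]\<close> leaves \<open>b dvd a\<close>.
\<close>
lemma primitive_prime_factorization_super_primitive:
  fixes f :: "'a::idom poly"
  assumes "primitive_poly f" "has_prime_factorization f"
  shows "super_primitive_poly f"
  unfolding super_primitive_poly_iff
proof (intro allI impI)
  fix a b :: 'a assume b: "b \<noteq> 0" and dvd: "\<forall>i. b dvd a * coeff f i"
  from assms(2) obtain P where P: "\<forall>p\<in>#P. prime_elem p" "f = prod_mset P"
    unfolding has_prime_factorization_def by blast
  have "degree p > 0" if "p \<in># P" for p
  proof -
    have "primitive_poly p"
      using primitive_poly_factor[OF assms(1)] P(2) that dvd_prod_mset by blast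
    then show ?thesis using primitive_poly_degree_0_unit P(1) that prime_elem_not_unit by blast
  qed
  moreover have "[:b:] dvd prod_mset P * [:a:]"
    using dvd P(2) by (simp add: const_poly_dvd_iff mult.commute)
  ultimately have "[:b:] dvd [:a:]" using prod_mset_prime_cancel_const[of P b "[:a:]"] P(1) b by blast
  then show "b dvd a" by simp
qed

text \<open>
  A Gauss lemma for super-primitive polynomials. It suffices to show that \<open>b\<close> divides every product
  of a coefficient of \<open>f\<close> and a coefficient of \<open>g\<close>: super-primitivity of \<open>f\<close> then gives that \<open>b\<close>
  divides each coefficient of \<open>g\<close>.

  The products are treated by two nested inductions, on the degree of \<open>g\<close> and, downwards, on the
  index \<open>i\<close> of the coefficient of \<open>f\<close>. If \<open>b\<close> divides \<open>f\<^sub>k g\<close> for all \<open>k > i\<close>, then modulo \<open>b\<close>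
  the only term left in the coefficient of \<open>f g\<close> at \<open>i + degree g\<close> is \<open>f\<^sub>i\<close> times the leading
  coefficient of \<open>g\<close>. So that product is divisible by \<open>b\<close>, and removing the leading term from
  \<open>f\<^sub>i g\<close> leaves a polynomial \<open>h\<close> that is zero or of smaller degree, with \<open>b\<close> still dividing
  \<open>f h\<close>. The outer induction hypothesis then applies to \<open>h\<close>.
\<close>
lemma super_primitive_cancel_const:
  fixes f g :: "'a::idom poly"
  assumes sp: "super_primitive_poly f" and b: "b \<noteq> 0" and dvd: "[:b:] dvd f * g"
  shows "[:b:] dvd g"
  using dvd
proof (induction "degree g" arbitrary: g rule: less_induct)
  case less
  let ?m = "degree g"
  have coeff_dvd: "[:b:] dvd smult (coeff f i) g" for i
  proof (induction "degree f - i" arbitrary: i rule: less_induct)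
    case (less i)
    note inner_IH = less
    have above: "b dvd coeff f k * coeff g j" if "k > i" for k j
    proof (cases "k \<le> degree f")
      case True
      then have "[:b:] dvd smult (coeff f k) g" using inner_IH that by simp
      then show ?thesis by (simp add: const_poly_dvd_iff)
    next
      case False
      then show ?thesis by (simp add: coeff_eq_0)
    qed
    have lead: "b dvd coeff f i * lead_coeff g"
    proof -
      let ?t = "\<lambda>k. coeff f k * coeff g (i + ?m - k)"
      have "coeff (f * g) (i + ?m) = ?t i + (\<Sum>k\<in>{..i + ?m} - {i}. ?t k)"
        unfolding coeff_mult by (subst sum.remove[of _ i]) auto
      moreover have "b dvd (\<Sum>k\<in>{..i + ?m} - {i}. ?t k)"
      proof (rule dvd_sum)
        fix k assume "k \<in> {..i + ?m} - {i}"
        \<comment> \<open>for \<open>k < i\<close> the index \<open>i + ?m - k\<close> exceeds the degree of \<open>g\<close>\<close>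
        then have "k > i \<or> k < i" by auto
        then show "b dvd ?t k" using above by (auto simp: coeff_eq_0)
      qed
      moreover have "b dvd coeff (f * g) (i + ?m)"
        using \<open>[:b:] dvd f * g\<close> by (simp only: const_poly_dvd_iff)
      ultimately have "b dvd ?t i" by (simp only: dvd_add_left_iff)
      then show ?thesis by simp
    qed
    define h where "h = smult (coeff f i) g - monom (coeff f i * lead_coeff g) ?m"
    have dvd_monom: "[:b:] dvd monom (coeff f i * lead_coeff g) ?m"
      using lead by (simp add: const_poly_dvd_iff)
    have "[:b:] dvd h"
    proof (cases "h = 0")
      case False
      have "degree h \<le> ?m"
        unfolding h_def by (intro degree_diff_le degree_smult_le degree_monom_le)
      moreover have "coeff h ?m = 0" by (simp add: h_def)
      ultimately have "degree h < ?m" using False by (metis le_neq_implies_less leading_coeff_0_iff)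
      moreover have "[:b:] dvd f * h"
      proof -
        have "f * h = smult (coeff f i) (f * g) - f * monom (coeff f i * lead_coeff g) ?m"
          by (simp add: h_def right_diff_distrib)
        then show ?thesis
          using \<open>[:b:] dvd f * g\<close> dvd_monom by (simp add: dvd_diff dvd_smult)
      qed
      ultimately show ?thesis using \<open>\<And>h. degree h < ?m \<Longrightarrow> [:b:] dvd f * h \<Longrightarrow> [:b:] dvd h\<close> by blast
    qed simp
    then have "[:b:] dvd h + monom (coeff f i * lead_coeff g) ?m"
      using dvd_monom by (rule dvd_add)
    then show ?case by (simp add: h_def)
  qed
  have "b dvd coeff g j" for j
  proof -
    have "\<forall>i. b dvd coeff g j * coeff f i"
      using coeff_dvd by (simp add: const_poly_dvd_iff mult.commute)
    then show ?thesis using sp b unfolding super_primitive_poly_iff by blast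
  qed
  then show ?case by (simp add: const_poly_dvd_iff)
qed


section \<open>Passage to the quotient field\<close>

lemma clear_denominators:
  fixes r :: "'a::idom fract poly"
  obtains c k where "c \<noteq> 0" "smult (to_fract c) r = map_poly to_fract k"
proof -
  have "\<exists>c k. c \<noteq> 0 \<and> smult (to_fract c) r = map_poly to_fract k"
  proof (induction r)
    case 0
    show ?case by (intro exI[of _ 1] exI[of _ 0]) simp
  next
    case (pCons a r)
    then obtain c k where ck: "c \<noteq> 0" "smult (to_fract c) r = map_poly to_fract k" by blast
    obtain x y where a: "a = to_fract x / to_fract y" "y \<noteq> 0"
      by (cases a) (auto simp: Fract_conv_to_fract)
    have "smult (to_fract (y * c)) (pCons a r) = map_poly to_fract (pCons (c * x) (smult y k))"
      using a ck(2) by (simp add: map_poly_pCons smult_smult[symmetric] del: smult_smult)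
    then show ?case using ck(1) a(2) by (metis mult_eq_0_iff)
  qed
  then show ?thesis using that by blast
qed

lemma degree_fract_poly [simp]: "degree (map_poly to_fract f) = degree (f::'a::idom poly)"
  by (rule degree_map_poly) simp

text \<open>
  A factorization over \<open>K\<close> becomes, after clearing denominators, a factorization in \<open>D[T]\<close> of a
  constant multiple of \<open>f\<close>. The prime \<open>f\<close> divides one of the two factors, which thus has full
  degree and leaves the other one constant.
\<close>
lemma prime_elem_imp_irreducible_fract_poly:
  fixes f :: "'a::idom poly"
  assumes "prime_elem f" "degree f > 0"
  shows "irreducible (map_poly to_fract f)"
proof (rule irreducibleI)
  show "map_poly to_fract f \<noteq> 0" using assms by auto
  show "\<not> map_poly to_fract f dvd 1" using degree_pos_not_unit[of "map_poly to_fract f"] assms(2) by simp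
  fix g h assume gh: "map_poly to_fract f = g * h"
  have nz: "g \<noteq> 0" "h \<noteq> 0" using gh assms(2) by auto
  have deg: "degree f = degree g + degree h"
    using gh nz degree_fract_poly[of f] by (simp add: degree_mult_eq)
  obtain c g' where g': "c \<noteq> 0" "smult (to_fract c) g = map_poly to_fract g'" by (rule clear_denominators)
  obtain d h' where h': "d \<noteq> 0" "smult (to_fract d) h = map_poly to_fract h'" by (rule clear_denominators)
  have dg: "degree g' = degree g" "degree h' = degree h"
    using g' h' by (metis degree_fract_poly degree_smult_eq to_fract_eq_0_iff)+
  have nz': "g' \<noteq> 0" "h' \<noteq> 0" using g' h' nz by auto
  have "map_poly to_fract (g' * h') = smult (to_fract c) g * smult (to_fract d) h"
    using g'(2) h'(2) by simp
  also have "\<dots> = map_poly to_fract (smult (c * d) f)" using gh by (simp add: mult.commute)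
  finally have "g' * h' = smult (c * d) f" by (simp only: fract_poly_eq_iff)
  then have "f dvd g' * h'" by (simp add: dvd_smult)
  then have "f dvd g' \<or> f dvd h'" using assms(1) prime_elem_dvd_multD by blast
  then have "degree f \<le> degree g \<or> degree f \<le> degree h"
    using dvd_imp_degree_le nz' dg by metis
  then have "degree h = 0 \<or> degree g = 0" using deg by auto
  then show "g dvd 1 \<or> h dvd 1"
    using nz by (auto elim!: degree_eq_zeroE simp: is_unit_pCons_iff)
qed

text \<open>
  Clearing denominators in a quotient over \<open>K\<close> gives \<open>[:c:] * g = f * k\<close> in \<open>D[T]\<close>; by the Gauss
  lemma \<open>c\<close> divides \<open>k\<close> and can be cancelled.
\<close>
lemma super_primitive_fract_poly_dvd:
  fixes f g :: "'a::idom poly"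
  assumes "super_primitive_poly f" "map_poly to_fract f dvd map_poly to_fract g"
  shows "f dvd g"
proof -
  obtain r where r: "map_poly to_fract g = map_poly to_fract f * r" using assms(2) by (elim dvdE)
  obtain c k where ck: "c \<noteq> 0" "smult (to_fract c) r = map_poly to_fract k" by (rule clear_denominators)
  have "map_poly to_fract (smult c g) = map_poly to_fract f * smult (to_fract c) r"
    using r by simp
  also have "\<dots> = map_poly to_fract (f * k)" by (simp add: ck(2))
  finally have "map_poly to_fract (smult c g) = map_poly to_fract (f * k)" .
  then have eq: "[:c:] * g = f * k" by (simp only: fract_poly_eq_iff) simp
  then have "[:c:] dvd f * k" by (metis dvd_triv_left)
  then have "[:c:] dvd k" using super_primitive_cancel_const[OF assms(1) ck(1)] by blast
  then obtain l where "k = [:c:] * l" by (elim dvdE)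
  then have "[:c:] * g = [:c:] * (f * l)" using eq by (simp only: mult.left_commute)
  then have "g = f * l" using ck(1) by (subst (asm) mult_left_cancel) auto
  then show ?thesis by simp
qed

text \<open>
  Over the field \<open>K\<close> irreducible polynomials are prime, and for a super-primitive \<open>f\<close> divisibility
  over \<open>K\<close> descends to \<open>D[T]\<close>.
\<close>
lemma super_primitive_irreducible_fract_poly_imp_prime_elem:
  fixes f :: "'a::idom poly"
  assumes "super_primitive_poly f" "degree f > 0" "irreducible (map_poly to_fract f)"
  shows "prime_elem f"
proof (rule prime_elemI)
  show "f \<noteq> 0" "\<not> f dvd 1" using assms(2) degree_pos_not_unit by auto
  fix g h assume "f dvd g * h"
  then have "map_poly to_fract f dvd map_poly to_fract (g * h)" by (rule fract_poly_dvd)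
  then have "map_poly to_fract f dvd map_poly to_fract g * map_poly to_fract h"
    by (simp only: fract_poly_mult)
  then have "map_poly to_fract f dvd map_poly to_fract g \<or> map_poly to_fract f dvd map_poly to_fract h"
    using field_poly_irreducible_imp_prime[OF assms(3)] prime_elem_dvd_multD by blast
  then show "f dvd g \<or> f dvd h" using super_primitive_fract_poly_dvd[OF assms(1)] by blast
qed

text \<open>
  A proper factorization of a primitive polynomial has two nonconstant factors, so repeated
  splitting lowers the degree and stops at irreducible factors.
\<close>
lemma primitive_poly_has_prime_factorization_if_irreducibles_prime:
  fixes f :: "'a::idom poly"
  assumes "\<And>q::'a poly. degree q > 0 \<Longrightarrow> irreducible q \<Longrightarrow> prime_elem q"
    and "primitive_poly f" "degree f > 0"
  shows "has_prime_factorization f"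
  using assms(2,3)
proof (induction "degree f" arbitrary: f rule: less_induct)
  case less
  show ?case
  proof (cases "irreducible f")
    case True
    then show ?thesis using assms(1) less.prems(2) has_prime_factorization_prime_elem by blast
  next
    case False
    have "f \<noteq> 0" "\<not> f dvd 1" using less.prems(2) degree_pos_not_unit by auto
    with False obtain g h where gh: "f = g * h" "\<not> g dvd 1" "\<not> h dvd 1"
      by (auto simp: irreducible_def)
    have prim: "primitive_poly g" "primitive_poly h"
      using primitive_poly_factor[OF less.prems(1)] gh(1) by auto
    have pos: "degree g > 0" "degree h > 0"
      using primitive_poly_degree_0_unit prim gh(2,3) by blast+
    have "degree g < degree f" "degree h < degree f"
      using prime_factor_degree_less[of g h] prime_factor_degree_less[of h g] pos \<open>f \<noteq> 0\<close> gh(1)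
      by (simp_all add: mult.commute)
    then show ?thesis
      using less.hyps prim pos has_prime_factorization_mult gh(1) by blast
  qed
qed


section \<open>Characterizations of TPDF polynomial rings\<close>

theorem corollary3p8:
  shows "(TPDF_domain TYPE('a::idom poly) \<longleftrightarrow>
            TPDF_domain TYPE('a) \<and>
            (\<forall>f::'a poly. degree f > 0 \<and> primitive_poly f \<longrightarrow> has_prime_factorization f))
       \<and> (TPDF_domain TYPE('a poly) \<longleftrightarrow>
            TPDF_domain TYPE('a) \<and> PSP_domain TYPE('a) \<and>
            (\<forall>f::'a poly. degree f > 0 \<and> irreducible f \<longrightarrow>
               irreducible (map_poly to_fract f :: 'a fract poly)))"
    (is "(?C1 \<longleftrightarrow> ?D \<and> ?F) \<and> (?C1 \<longleftrightarrow> ?D \<and> ?P \<and> ?I)")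
proof -
  have "?D \<and> ?F" if ?C1
    using that strong_Furstenberg_coefficients PDF_domain_coefficients
      primitive_poly_has_prime_factorization
    unfolding TPDF_domain_def by blast
  moreover have ?C1 if "?D \<and> ?F"
    using that strong_Furstenberg_poly PDF_domain_poly unfolding TPDF_domain_def by blast
  moreover have "?P \<and> ?I" if F: ?F
  proof
    show ?P
      unfolding PSP_domain_def
    proof (intro allI impI)
      fix f :: "'a poly" assume prim: "primitive_poly f"
      show "super_primitive_poly f"
      proof (cases "degree f = 0")
        case True
        then show ?thesis using prim primitive_poly_degree_0_unit super_primitive_poly_unit by blast
      next
        case False
        then show ?thesis using F prim primitive_prime_factorization_super_primitive by blast
      qed
    qed
    show ?I
      using F irreducible_degree_pos_primitive irreducible_has_prime_factorization_imp_prime_elem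
        prime_elem_imp_irreducible_fract_poly by blast
  qed
  moreover have ?F if "?P \<and> ?I"
  proof -
    have "prime_elem q" if "degree q > 0" "irreducible q" for q :: "'a poly"
      using that \<open>?P \<and> ?I\<close> irreducible_degree_pos_primitive
        super_primitive_irreducible_fract_poly_imp_prime_elem
      unfolding PSP_domain_def by blast
    then show ?thesis using primitive_poly_has_prime_factorization_if_irreducibles_prime by blast
  qed
  ultimately show ?thesis by blast
qed

end
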